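(* For every decreasing and strictly positive sequence $(\tau(n))_{n\ge 1}$ with $\tau(n)\to 0$ there is a topological dynamical system $(X,T)$ with zero topological entropy that satisfies: 1. There exist $x\in X$ and $f\in\mathcal{C}(X)$ such that $|f(y)|=1$ for all $y\in X$ and $$\liminf_{N\to\infty}\frac{1}{\log(N)\cdot\tau(N)}\sum_{n=1}^{N}\frac{\mu(n)f(T^n x)}{n}>0.$$ 2. The system $(X,T)$ satisfies the logarithmically averaged Möbius disjointness conjecture, that is, for every $f\in\mathcal{C}(X)$ and every $x\in X$, $$\lim_{N\to\infty}\frac{1}{\log N}\sum_{n=1}^{N}\frac{\mu(n)f(T^n x)}{n}=0.$$
   Context: A topological dynamical system is a pair $(X,T)$ where $X$ is a compact metric space and $T:X\to X$ is continuous (not necessarily invertible). $\mathcal{C}(X)$ denotes the space of continuous functions on $X$; the function $f$ in item 1 is real-valued, as is implicit in the liminf being positive. $\mu:\mathbb{N}\to\{-1,0,1\}$ denotes the Möbius function. *)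

theory Defs
  imports
    "HOL-Analysis.Analysis"
    "HOL-Computational_Algebra.Computational_Algebra"
begin

text \<open>The Moebius function. The value at 0 is 0, as 0 is not squarefree.\<close>

definition moebius_mu :: "nat \<Rightarrow> int" where
  "moebius_mu n = (if squarefree n then (- 1) ^ card (prime_factors n) else 0)"

text \<open>
  The space is the carrier \<open>mspace X\<close>; the values of \<open>T\<close> outside it are irrelevant. As compact metric
  spaces have at most the cardinality of the continuum, each is isometric to some
  \<open>X :: (nat \<Rightarrow> real) metric\<close>.
\<close>

definition topological_dynamical_system :: "'a metric \<Rightarrow> ('a \<Rightarrow> 'a) \<Rightarrow> bool" where
  "topological_dynamical_system X T \<longleftrightarrow>
     compact_space (mtopology_of X) \<and> continuous_map (mtopology_of X) (mtopology_of X) T"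

text \<open>
  Topological entropy in the form of Bowen and Dinaburg: a set \<open>E\<close> is \<open>(n, \<epsilon>)\<close>-spanning if it is
  \<open>\<epsilon>\<close>-dense for the metric \<open>d\<^sub>n(x, y) = max\<^bsub>i < n\<^esub> d(T\<^sup>i x, T\<^sup>i y)\<close>. On a topological dynamical
  system finite \<open>(n, \<epsilon>)\<close>-spanning sets exist for every \<open>\<epsilon> > 0\<close>, so the infimum below is an
  attained minimum; only outside that setting can it be the junk value \<open>Inf {} = 0\<close>.
\<close>

definition spanning_set :: "'a metric \<Rightarrow> ('a \<Rightarrow> 'a) \<Rightarrow> nat \<Rightarrow> real \<Rightarrow> 'a set \<Rightarrow> bool" where
  "spanning_set X T n \<epsilon> E \<longleftrightarrow>
     E \<subseteq> mspace X \<and>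
     (\<forall>x\<in>mspace X. \<exists>y\<in>E. \<forall>i<n. mdist X ((T ^^ i) x) ((T ^^ i) y) < \<epsilon>)"

definition spanning_number :: "'a metric \<Rightarrow> ('a \<Rightarrow> 'a) \<Rightarrow> nat \<Rightarrow> real \<Rightarrow> nat" where
  "spanning_number X T n \<epsilon> = Inf {card E |E. finite E \<and> spanning_set X T n \<epsilon> E}"

text \<open>The supremum over \<open>\<epsilon> > 0\<close> is the limit as \<open>\<epsilon>\<close> tends to 0, by monotonicity in \<open>\<epsilon>\<close>.\<close>

definition topological_entropy :: "'a metric \<Rightarrow> ('a \<Rightarrow> 'a) \<Rightarrow> ereal" where
  "topological_entropy X T =
     (SUP \<epsilon>\<in>{0<..}. limsup (\<lambda>n. ereal (ln (real (spanning_number X T n \<epsilon>)) / real n)))"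

end

theory Submission
  imports Defs "HOL-Real_Asymp.Real_Asymp"
begin

text \<open>
  The system is the subshift generated by a sequence \<open>x\<close> of signs that is \<open>-1\<close> on a very sparse set
  \<open>A\<close> of integers with \<open>\<mu>(n) = -1\<close>, and \<open>1\<close> elsewhere; \<open>f\<close> reads off the sign at position 0. Then
  \<open>\<mu>(n) x\<^sub>n = \<mu>(n) + 2\<close> on \<open>A\<close> and \<open>\<mu>(n) x\<^sub>n = \<mu>(n)\<close> off \<open>A\<close>, so
  \<open>\<Sum>\<^bsub>n \<le> N\<^esub> \<mu>(n) x\<^sub>n / n\<close> is \<open>\<Sum>\<^bsub>n \<le> N\<^esub> \<mu>(n) / n\<close> plus twice \<open>\<Sum>\<^bsub>a \<in> A, a \<le> N\<^esub> 1 / a\<close>. The first sum is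
  bounded by an elementary argument (\<open>abs_sum_moebius_mu_over_n_le\<close>), so the correlation is as large
  as the logarithmic size of \<open>A\<close>.

  The integers with \<open>\<mu>(n) = -1\<close> have positive lower logarithmic density
  (\<open>sum_moebius_mu_minus_one_ge\<close>): squarefree numbers have positive density, and the boundedness of
  \<open>\<Sum> \<mu>(n) / n\<close> says that both signs of \<open>\<mu>\<close> get the same share. Selecting greedily a subset \<open>A\<close>
  in which \<open>a\<close> is followed by a gap of length at least \<open>g(a)\<close> divides the logarithmic sum up to \<open>N\<close>
  by at most \<open>g(N)\<close> (\<open>sum_reciprocals_le_times_greedy\<close>). With \<open>g\<close> close to \<open>1 / \<tau>\<close> this leaves a
  multiple of \<open>\<tau>(N) log N\<close>, while \<open>\<tau>(n) \<longlongrightarrow> 0\<close> makes the gaps of \<open>A\<close> tend to infinity.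

  Growing gaps are also the reason for the two other properties. A window of length \<open>L\<close> far out in
  \<open>x\<close> contains at most one \<open>-1\<close>, so that there are at most \<open>L + 1\<close> such windows, and concatenating
  them shows that \<open>x\<close> has subexponentially many words (\<open>words_signs_subexponential\<close>); hence the
  entropy vanishes. Every point \<open>u\<close> of the subshift inherits the growing gaps, so the shifts of \<open>u\<close>
  are close to the constant sequence 1 outside a set of times of logarithmic density 0
  (\<open>log_density_zero_window_meets\<close>). Logarithmic averages of \<open>\<mu>(n) f(T\<^sup>n u)\<close> therefore behave like
  those of \<open>\<mu>(n) f(1)\<close>, which vanish in the limit because \<open>\<Sum> \<mu>(n) / n\<close> is bounded.
\<close>


section \<open>The Moebius function\<close>

lemma moebius_mu_prime_mult:
  fixes p d :: nat
  assumes p: "prime p" and pd: "\<not> p dvd d"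
  shows "moebius_mu (p * d) = - moebius_mu d"
proof -
  have d: "d \<noteq> 0" using pd by (metis dvd_0_right)
  have "coprime p d" using p pd by (simp add: prime_imp_coprime)
  then have sq: "squarefree (p * d) \<longleftrightarrow> squarefree d"
    using squarefree_mult_coprime squarefree_prime[OF p] squarefree_multD(2) by blast
  have "prime_factors (p * d) = insert p (prime_factors d)"
    using p d by (simp add: prime_factors_product prime_prime_factors)
  moreover have "p \<notin> prime_factors d" using pd by auto
  ultimately show ?thesis unfolding moebius_mu_def using sq by simp
qed

text \<open>
  Fix a prime \<open>p\<close> dividing \<open>n\<close>. The divisors that are not multiples of \<open>p\<^sup>2\<close> come in pairs \<open>d\<close>, \<open>p * d\<close>
  with opposite values of \<open>\<mu>\<close>.
\<close>

lemma sum_moebius_mu_divisors: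
  fixes n :: nat
  assumes "n > 1"
  shows "(\<Sum>d | d dvd n. moebius_mu d) = 0"
proof -
  from assms obtain p where p: "prime p" "p dvd n"
    using prime_factor_nat[of n] by auto
  define D where "D = {d. d dvd n \<and> \<not> p dvd d}"
  have finD: "finite D" unfolding D_def using assms by auto
  have "(\<Sum>d | d dvd n. moebius_mu d) = (\<Sum>d\<in>D \<union> (*) p ` D. moebius_mu d)"
  proof (rule sum.mono_neutral_right)
    show "D \<union> (*) p ` D \<subseteq> {d. d dvd n}"
      using p by (auto simp: D_def intro!: divides_mult prime_imp_coprime)
    show "\<forall>d\<in>{d. d dvd n} - (D \<union> (*) p ` D). moebius_mu d = 0"
    proof
      fix d assume d: "d \<in> {d. d dvd n} - (D \<union> (*) p ` D)"
      then obtain e where e: "d = p * e" by (auto simp: D_def)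
      with d have "p dvd e" unfolding D_def using dvd_mult_right[of p e n] by auto
      then have "p ^ 2 dvd d" using e by (simp add: power2_eq_square mult_dvd_mono)
      then have "\<not> squarefree d" using p not_squarefreeI[of p d] not_prime_unit by blast
      then show "moebius_mu d = 0" by (simp add: moebius_mu_def)
    qed
  qed (use assms in auto)
  also have "\<dots> = (\<Sum>d\<in>D. moebius_mu d) + (\<Sum>d\<in>(*) p ` D. moebius_mu d)"
    using finD by (intro sum.union_disjoint) (auto simp: D_def)
  also have "(\<Sum>d\<in>(*) p ` D. moebius_mu d) = (\<Sum>d\<in>D. moebius_mu (p * d))"
    using p by (subst sum.reindex) (auto simp: inj_on_def)
  also have "\<dots> = (\<Sum>d\<in>D. - moebius_mu d)"
    using p by (intro sum.cong) (auto simp: D_def moebius_mu_prime_mult)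
  finally show ?thesis by (simp add: sum_negf)
qed

lemma abs_moebius_mu_le: "\<bar>moebius_mu n\<bar> \<le> 1"
  by (simp add: moebius_mu_def power_abs)

text \<open>
  Passing from \<open>N\<close> to \<open>N + 1\<close> increases \<open>N div d\<close> by 1 exactly when \<open>d\<close> divides \<open>N + 1\<close>, so that the sum
  grows by \<open>\<Sum>\<^bsub>d dvd N + 1\<^esub> \<mu>(d) = 0\<close>.
\<close>

lemma sum_moebius_mu_times_div:
  assumes "N \<ge> 1"
  shows "(\<Sum>d=1..N. moebius_mu d * int (N div d)) = 1"
  using assms
proof (induction N rule: dec_induct)
  case base
  then show ?case by (simp add: moebius_mu_def)
next
  case (step N)
  have eq: "{1..Suc N} \<inter> {d. d dvd Suc N} = {d. d dvd Suc N}"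
    by (auto dest: dvd_imp_le simp: Suc_le_eq intro!: Nat.gr0I)
  have "(\<Sum>d=1..Suc N. moebius_mu d * int (Suc N div d)) =
      (\<Sum>d=1..Suc N. moebius_mu d * int (N div d) + (if d dvd Suc N then moebius_mu d else 0))"
    by (intro sum.cong) (auto simp: div_Suc dvd_eq_mod_eq_0 algebra_simps)
  also have "\<dots> = (\<Sum>d=1..Suc N. moebius_mu d * int (N div d)) + (\<Sum>d | d dvd Suc N. moebius_mu d)"
  proof -
    have "(\<Sum>d=1..Suc N. if d dvd Suc N then moebius_mu d else 0) =
        (\<Sum>d\<in>{1..Suc N} \<inter> {d. d dvd Suc N}. moebius_mu d)"
      by (subst sum.inter_restrict) auto
    then show ?thesis unfolding sum.distrib eq by simp
  qed
  also have "(\<Sum>d | d dvd Suc N. moebius_mu d) = 0"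
    using step by (intro sum_moebius_mu_divisors) auto
  finally show ?case using step by simp
qed

text \<open>
  Replacing \<open>N div d\<close> by \<open>N / d\<close> in the previous identity costs at most 1 for each \<open>d\<close>, hence at most
  \<open>N\<close> in total; dividing by \<open>N\<close> gives a bounded sum.
\<close>

lemma abs_sum_moebius_mu_over_n_le:
  "\<bar>\<Sum>n=1..N. real_of_int (moebius_mu n) / real n\<bar> \<le> 2"
proof (cases "N \<ge> 1")
  case True
  let ?M = "\<Sum>n=1..N. real_of_int (moebius_mu n) / real n"
  have "\<bar>real N * ?M - 1\<bar> = \<bar>(\<Sum>d=1..N. real_of_int (moebius_mu d) * (real N / real d - real (N div d)))\<bar>"
  proof -
    have "1 = real_of_int (\<Sum>d=1..N. moebius_mu d * int (N div d))"
      using sum_moebius_mu_times_div[OF True] by simp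
    then have "1 = (\<Sum>d=1..N. real_of_int (moebius_mu d) * real (N div d))" by simp
    then show ?thesis
      by (simp add: sum_distrib_left right_diff_distrib sum_subtractf algebra_simps)
  qed
  also have "\<dots> \<le> (\<Sum>d=1..N. \<bar>real_of_int (moebius_mu d) * (real N / real d - real (N div d))\<bar>)"
    by (rule sum_abs)
  also have "\<dots> \<le> (\<Sum>d=1..N. 1)"
  proof (rule sum_mono)
    fix d assume "d \<in> {1..N}"
    \<comment> \<open>The difference is the fractional part of \<open>N / d\<close>.\<close>
    have "real (N div d) = of_int \<lfloor>real N / real d\<rfloor>" by (simp add: floor_divide_of_nat_eq)
    then have "\<bar>real N / real d - real (N div d)\<bar> \<le> 1" by linarith
    moreover have "\<bar>real_of_int (moebius_mu d)\<bar> \<le> 1" using abs_moebius_mu_le[of d] by linarith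
    ultimately show "\<bar>real_of_int (moebius_mu d) * (real N / real d - real (N div d))\<bar> \<le> 1"
      by (simp add: abs_mult mult_le_one)
  qed
  finally have "\<bar>real N * ?M\<bar> \<le> real N + 1" by simp
  also have "\<dots> \<le> real N * 2" using True by simp
  finally have "real N * \<bar>?M\<bar> \<le> real N * 2" by (simp add: abs_mult)
  then show ?thesis by (rule mult_left_le_imp_le) (use True in auto)
qed auto

lemma sum_inverse_squares_le: "(\<Sum>b=1..N. 1 / real b ^ 2) \<le> 2"
proof -
  have "(\<Sum>b=1..Suc N. 1 / real b ^ 2) \<le> 2 - 1 / real (Suc N)" for N
  proof (induction N)
    case (Suc N)
    \<comment> \<open>The bound telescopes as \<open>1 / b\<^sup>2 \<le> 1 / (b - 1) - 1 / b\<close>.\<close>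
    have "1 / real (Suc (Suc N)) ^ 2 \<le> 1 / real (Suc N) - 1 / real (Suc (Suc N))"
      by (simp add: divide_simps power2_eq_square)
    then show ?case using Suc by simp
  qed auto
  from this[of "N - 1"] show ?thesis
    by (cases N) (auto intro: order_trans simp del: sum.cl_ivl_Suc)
qed

text \<open>
  Squarefree numbers have positive logarithmic density: every \<open>n \<le> N\<close> is \<open>a * b\<^sup>2\<close> with
  \<open>a, b \<le> N\<close> and \<open>a\<close> squarefree, and the sum of the \<open>1 / b\<^sup>2\<close> is at most 2.
\<close>

lemma harm_le_sum_abs_moebius_mu:
  "harm N \<le> 2 * (\<Sum>n=1..N. \<bar>real_of_int (moebius_mu n)\<bar> / real n)"
proof -
  let ?f = "\<lambda>n::nat. (squarefree_part n, square_part n)"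
  let ?w = "\<lambda>(a, b). \<bar>real_of_int (moebius_mu a)\<bar> / real a * (1 / real b ^ 2)"
  have inj: "inj_on ?f {1..N}"
    by (rule inj_onI) (metis prod.inject squarefree_decompose)
  have "harm N = (\<Sum>n=1..N. ?w (?f n))"
    unfolding harm_def
  proof (rule sum.cong)
    fix n assume "n \<in> {1..N}"
    have "real n = real (squarefree_part n) * real (square_part n) ^ 2"
      by (metis of_nat_mult of_nat_power squarefree_decompose)
    moreover have "\<bar>real_of_int (moebius_mu (squarefree_part n))\<bar> = 1"
      by (simp add: moebius_mu_def power_abs)
    ultimately show "inverse (real n) = ?w (?f n)" by (simp add: field_simps)
  qed auto
  also have "\<dots> = (\<Sum>x\<in>?f ` {1..N}. ?w x)"
    using inj by (subst sum.reindex) auto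
  also have "\<dots> \<le> (\<Sum>x\<in>{1..N} \<times> {1..N}. ?w x)"
  proof (rule sum_mono2)
    show "?f ` {1..N} \<subseteq> {1..N} \<times> {1..N}"
    proof safe
      fix n assume n: "n \<in> {1..N}"
      have a: "squarefree_part n dvd n" by (metis dvd_triv_left squarefree_decompose)
      have b: "square_part n dvd n"
        using square_part_square_dvd[of n] by (metis dvd_mult_left power2_eq_square)
      show "squarefree_part n \<in> {1..N}" "square_part n \<in> {1..N}"
        using n dvd_imp_le[OF a] dvd_imp_le[OF b] dvd_pos_nat[OF _ a] dvd_pos_nat[OF _ b] by auto
    qed
  qed auto
  also have "\<dots> = (\<Sum>n=1..N. \<bar>real_of_int (moebius_mu n)\<bar> / real n) * (\<Sum>b=1..N. 1 / real b ^ 2)"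
    by (simp only: sum_product sum.cartesian_product)
  also have "\<dots> \<le> (\<Sum>n=1..N. \<bar>real_of_int (moebius_mu n)\<bar> / real n) * 2"
    by (intro mult_left_mono sum_inverse_squares_le sum_nonneg) auto
  finally show ?thesis by simp
qed

text \<open>
  The indicator of \<open>\<mu>(n) = -1\<close> is \<open>(|\<mu>(n)| - \<mu>(n)) / 2\<close>; the first term contributes a positive proportion of
  \<open>harm N\<close> and the second a bounded amount.
\<close>

lemma sum_moebius_mu_minus_one_ge:
  "(\<Sum>n | n \<in> {1..N} \<and> moebius_mu n = -1. 1 / real n) \<ge> harm N / 4 - 1"
proof -
  have "(\<Sum>n | n \<in> {1..N} \<and> moebius_mu n = -1. 1 / real n) =
      (\<Sum>n=1..N. if moebius_mu n = -1 then 1 / real n else 0)"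
    by (intro sum.mono_neutral_cong_left) auto
  also have "\<dots> = (\<Sum>n=1..N. (\<bar>real_of_int (moebius_mu n)\<bar> / real n - real_of_int (moebius_mu n) / real n) / 2)"
  proof (rule sum.cong)
    fix n
    have "moebius_mu n \<in> {-1, 0, 1}" using abs_moebius_mu_le[of n] by (auto simp: abs_le_iff)
    then show "(if moebius_mu n = -1 then 1 / real n else 0) =
        (\<bar>real_of_int (moebius_mu n)\<bar> / real n - real_of_int (moebius_mu n) / real n) / 2" by auto
  qed auto
  also have "\<dots> = ((\<Sum>n=1..N. \<bar>real_of_int (moebius_mu n)\<bar> / real n) -
      (\<Sum>n=1..N. real_of_int (moebius_mu n) / real n)) / 2"
    by (simp add: sum_divide_distrib[symmetric] sum_subtractf)
  also have "\<dots> \<ge> (harm N / 2 - 2) / 2"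
    using harm_le_sum_abs_moebius_mu[of N] abs_sum_moebius_mu_over_n_le[of N] by simp
  finally show ?thesis by simp
qed


section \<open>Sets of naturals with growing gaps\<close>

definition separated_from :: "nat \<Rightarrow> nat \<Rightarrow> nat set \<Rightarrow> bool" where
  "separated_from m L A \<longleftrightarrow> (\<forall>a\<in>A. \<forall>b\<in>A. m \<le> a \<longrightarrow> a < b \<longrightarrow> a + L \<le> b)"

definition gaps_tend_to_infinity :: "nat set \<Rightarrow> bool" where
  "gaps_tend_to_infinity A \<longleftrightarrow> (\<forall>L. \<exists>m. separated_from m L A)"

text \<open>
  If \<open>a > m + L\<close> lies in \<open>A\<close>, then \<open>L / a\<close> is at most the sum of \<open>1 / j\<close> over the \<open>L\<close> integers up to
  \<open>a\<close>, and these blocks are disjoint for different \<open>a\<close>.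
\<close>

lemma sum_reciprocals_separated_le:
  assumes sep: "separated_from m L A" and L: "L \<ge> 1"
  shows "(\<Sum>a\<in>A \<inter> {1..N}. 1 / real a) \<le> harm (m + L) + harm N / real L"
proof -
  define C where "C = A \<inter> {m + L<..N}"
  have [simp]: "finite C" by (simp add: C_def)
  have "(\<Sum>a\<in>A \<inter> {1..N}. 1 / real a) \<le> (\<Sum>a\<in>{1..m + L} \<union> C. 1 / real a)"
    by (intro sum_mono2) (auto simp: C_def)
  also have "\<dots> = harm (m + L) + (\<Sum>a\<in>C. 1 / real a)"
    by (subst sum.union_disjoint) (auto simp: C_def harm_def inverse_eq_divide)
  also have "(\<Sum>a\<in>C. 1 / real a) \<le> harm N / real L"
  proof -
    have "real L * (\<Sum>a\<in>C. 1 / real a) = (\<Sum>a\<in>C. \<Sum>j\<in>{a - L<..a}. 1 / real a)"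
      by (simp add: sum_distrib_left C_def)
    also have "\<dots> \<le> (\<Sum>a\<in>C. \<Sum>j\<in>{a - L<..a}. 1 / real j)"
      by (intro sum_mono) (auto simp: C_def intro!: divide_left_mono)
    also have "\<dots> = (\<Sum>j\<in>(\<Union>a\<in>C. {a - L<..a}). 1 / real j)"
    proof (rule sum.UNION_disjoint[symmetric])
      have "{a - L<..a} \<inter> {b - L<..b} = {}" if "a \<in> C" "b \<in> C" "a < b" for a b
        using sep that by (force simp: separated_from_def C_def)
      then show "\<forall>a\<in>C. \<forall>b\<in>C. a \<noteq> b \<longrightarrow> {a - L<..a} \<inter> {b - L<..b} = {}"
        by (metis Int_commute linorder_neqE_nat)
    qed auto
    also have "\<dots> \<le> (\<Sum>j=1..N. 1 / real j)"
      by (intro sum_mono2) (auto simp: C_def)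
    finally show ?thesis
      using L by (simp add: harm_def inverse_eq_divide field_simps)
  qed
  finally show ?thesis by simp
qed

lemma harm_le_ln_plus_one:
  assumes "N \<ge> 1"
  shows "harm N \<le> ln (real N) + 1"
proof -
  have "harm (Suc (N - 1)) - ln (real (Suc (N - 1))) \<le> harm (Suc 0) - ln (real (Suc 0))"
    using decseq_harm_diff_ln by (rule decseqD) auto
  then show ?thesis using assms by (simp add: harm_expand)
qed

lemma log_density_zero_if_gaps_tend_to_infinity:
  assumes "gaps_tend_to_infinity A"
  shows "(\<lambda>N. (\<Sum>a\<in>A \<inter> {1..N}. 1 / real a) / ln (real N)) \<longlonglongrightarrow> 0"
proof (rule order_tendstoI)
  fix e :: real assume "e < 0"
  have "0 \<le> (\<Sum>a\<in>A \<inter> {1..N}. 1 / real a) / ln (real N)" for N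
    by (cases "N = 0") (auto intro!: divide_nonneg_nonneg sum_nonneg)
  then show "\<forall>\<^sub>F N in sequentially. e < (\<Sum>a\<in>A \<inter> {1..N}. 1 / real a) / ln (real N)"
    using \<open>e < 0\<close> by (intro always_eventually allI) (rule less_le_trans)
next
  fix e :: real assume "0 < e"
  then obtain L :: nat where L: "L > 0" "1 / real L < e"
    using nat_approx_posE[of e] by (metis zero_less_Suc)
  obtain m where m: "separated_from m L A"
    using assms by (auto simp: gaps_tend_to_infinity_def)
  have "((\<lambda>N. (harm (m + L) + (ln (real N) + 1) / real L) / ln (real N)) \<longlongrightarrow> 1 / real L) sequentially"
    using L(1) by (real_asymp simp: inverse_eq_divide)
  then have "\<forall>\<^sub>F N in sequentially. (harm (m + L) + (ln (real N) + 1) / real L) / ln (real N) < e"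
    using L(2) by (rule order_tendstoD)
  then show "\<forall>\<^sub>F N in sequentially. (\<Sum>a\<in>A \<inter> {1..N}. 1 / real a) / ln (real N) < e"
    using eventually_ge_at_top[of 2]
  proof eventually_elim
    case (elim N)
    have "(\<Sum>a\<in>A \<inter> {1..N}. 1 / real a) \<le> harm (m + L) + harm N / real L"
      using L(1) by (intro sum_reciprocals_separated_le m) auto
    also have "harm N / real L \<le> (ln (real N) + 1) / real L"
      using elim by (intro divide_right_mono harm_le_ln_plus_one) auto
    finally have "(\<Sum>a\<in>A \<inter> {1..N}. 1 / real a) / ln (real N) \<le>
        (harm (m + L) + (ln (real N) + 1) / real L) / ln (real N)"
      using elim by (intro divide_right_mono) auto
    with elim show ?case by linarith
  qed
qed

text \<open>
  The times \<open>n\<close> at which the window of length \<open>K\<close> starting at \<open>n\<close> meets \<open>A\<close> form a union of \<open>K\<close> translates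
  of \<open>A\<close>, each of which has growing gaps.
\<close>

lemma log_density_zero_window_meets:
  assumes "gaps_tend_to_infinity A"
  shows "(\<lambda>N. (\<Sum>n\<in>{n. \<exists>i<K. n + i \<in> A} \<inter> {1..N}. 1 / real n) / ln (real N)) \<longlonglongrightarrow> 0"
proof -
  let ?B = "\<lambda>i. {n. n + i \<in> A}" and ?E = "{n. \<exists>i<K. n + i \<in> A}"
  have gaps: "gaps_tend_to_infinity (?B i)" for i
    unfolding gaps_tend_to_infinity_def
  proof
    fix L
    obtain m where "separated_from m L A"
      using assms by (auto simp: gaps_tend_to_infinity_def)
    then have "separated_from m L (?B i)"
      by (fastforce simp: separated_from_def)
    then show "\<exists>m. separated_from m L (?B i)" ..
  qed
  have le: "(\<Sum>n\<in>?E \<inter> {1..N}. 1 / real n) \<le> (\<Sum>i<K. \<Sum>n\<in>?B i \<inter> {1..N}. 1 / real n)" for N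
  proof -
    have "(\<Sum>n\<in>?E \<inter> {1..N}. 1 / real n) \<le> (\<Sum>n\<in>?E \<inter> {1..N}. \<Sum>i<K. if n + i \<in> A then 1 / real n else 0)"
    proof (rule sum_mono)
      fix n assume "n \<in> ?E \<inter> {1..N}"
      then obtain i where i: "i < K" "n + i \<in> A" by blast
      then show "1 / real n \<le> (\<Sum>i<K. if n + i \<in> A then 1 / real n else 0)"
        using member_le_sum[of i "{..<K}" "\<lambda>i. if n + i \<in> A then 1 / real n else 0"] by auto
    qed
    also have "\<dots> \<le> (\<Sum>n\<in>{1..N}. \<Sum>i<K. if n + i \<in> A then 1 / real n else 0)"
      by (intro sum_mono2 sum_nonneg) auto
    also have "\<dots> = (\<Sum>i<K. \<Sum>n\<in>{1..N}. if n + i \<in> A then 1 / real n else 0)"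
      by (rule sum.swap)
    also have "\<dots> = (\<Sum>i<K. \<Sum>n\<in>?B i \<inter> {1..N}. 1 / real n)"
      by (intro sum.cong refl sum.mono_neutral_cong_right) auto
    finally show ?thesis .
  qed
  have "(\<lambda>N. \<Sum>i<K. (\<Sum>n\<in>?B i \<inter> {1..N}. 1 / real n) / ln (real N)) \<longlonglongrightarrow> (\<Sum>i<K. 0)"
    by (intro tendsto_sum log_density_zero_if_gaps_tend_to_infinity gaps)
  then have lim: "(\<lambda>N. (\<Sum>i<K. \<Sum>n\<in>?B i \<inter> {1..N}. 1 / real n) / ln (real N)) \<longlonglongrightarrow> 0"
    by (simp add: sum_divide_distrib)
  have nonneg: "0 \<le> ln (real N)" for N :: nat
    by (cases "N = 0") auto
  show ?thesis
  proof (rule tendsto_sandwich[OF _ _ tendsto_const lim])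
    show "\<forall>\<^sub>F N in sequentially. 0 \<le> (\<Sum>n\<in>?E \<inter> {1..N}. 1 / real n) / ln (real N)"
      by (intro always_eventually allI divide_nonneg_nonneg sum_nonneg nonneg) auto
    show "\<forall>\<^sub>F N in sequentially. (\<Sum>n\<in>?E \<inter> {1..N}. 1 / real n) / ln (real N) \<le>
        (\<Sum>i<K. \<Sum>n\<in>?B i \<inter> {1..N}. 1 / real n) / ln (real N)"
      by (intro always_eventually allI divide_right_mono le nonneg)
  qed
qed

text \<open>
  Scanning \<open>P\<close> upwards, \<open>n\<close> is selected unless it falls into the gap reserved by an element \<open>a\<close> selected
  earlier, which is \<open>{a..<a + g a}\<close>. The range of \<open>a\<close> is written as a set for the sake of the termination
  proof, where the congruence rule for bounded quantifiers supplies \<open>a < n\<close>.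
\<close>

function greedy :: "nat set \<Rightarrow> (nat \<Rightarrow> nat) \<Rightarrow> nat \<Rightarrow> bool" where
  "greedy P g n \<longleftrightarrow> n \<in> P \<and> (\<forall>a\<in>{..<n}. greedy P g a \<longrightarrow> a + g a \<le> n)"
  by auto
termination by (relation "Wellfounded.measure (\<lambda>(P, g, n). n)") auto

declare greedy.simps [simp del]

text \<open>
  The last property records that an element of \<open>P\<close> is discarded only for lying in a reserved gap; with
  \<open>g n \<ge> 1\<close> a selected element lies in its own one.
\<close>

lemma greedy_subset:
  fixes P :: "nat set" and g :: "nat \<Rightarrow> nat"
  assumes g: "\<And>n. g n \<ge> 1"
  obtains A where "A \<subseteq> P" "\<And>a b. a \<in> A \<Longrightarrow> b \<in> A \<Longrightarrow> a < b \<Longrightarrow> a + g a \<le> b"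
    "\<And>n. n \<in> P \<Longrightarrow> \<exists>a\<in>A. a \<le> n \<and> n < a + g a"
proof
  let ?A = "{n. greedy P g n}"
  show "?A \<subseteq> P" using greedy.simps[of P g] by blast
  show "a + g a \<le> b" if "a \<in> ?A" "b \<in> ?A" "a < b" for a b
    using that greedy.simps[of P g b] by blast
  show "\<exists>a\<in>?A. a \<le> n \<and> n < a + g a" if nP: "n \<in> P" for n
  proof (cases "greedy P g n")
    case True
    then show ?thesis using g[of n] by (intro bexI[of _ n]) auto
  next
    case False
    then obtain a where "a < n" "greedy P g a" "n < a + g a"
      using nP greedy.simps[of P g n] by (metis lessThan_iff not_le)
    then show ?thesis by (intro bexI[of _ a]) auto
  qed
qed

text \<open>
  The reserved gaps \<open>{a..<a + g a}\<close> cover \<open>P\<close>, and each of them carries a sum of reciprocals of at most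
  \<open>g a / a \<le> g N / a\<close>.
\<close>

lemma sum_reciprocals_le_times_greedy:
  fixes g :: "nat \<Rightarrow> nat"
  assumes mono: "mono g" and P0: "0 \<notin> P" and AP: "A \<subseteq> P"
    and sep: "\<And>a b. a \<in> A \<Longrightarrow> b \<in> A \<Longrightarrow> a < b \<Longrightarrow> a + g a \<le> b"
    and cover: "\<And>n. n \<in> P \<Longrightarrow> \<exists>a\<in>A. a \<le> n \<and> n < a + g a"
  shows "(\<Sum>n\<in>P \<inter> {1..N}. 1 / real n) \<le> real (g N) * (\<Sum>a\<in>A \<inter> {1..N}. 1 / real a)"
proof -
  have pos: "a \<ge> 1" if "a \<in> A" for a
    using that AP P0 by (cases a) auto
  have "(\<Sum>n\<in>P \<inter> {1..N}. 1 / real n) \<le> (\<Sum>n\<in>(\<Union>a\<in>A \<inter> {1..N}. {a..<a + g a}). 1 / real n)"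
  proof (rule sum_mono2)
    show "P \<inter> {1..N} \<subseteq> (\<Union>a\<in>A \<inter> {1..N}. {a..<a + g a})"
      using cover pos by fastforce
  qed auto
  also have "\<dots> = (\<Sum>a\<in>A \<inter> {1..N}. \<Sum>n\<in>{a..<a + g a}. 1 / real n)"
  proof (rule sum.UNION_disjoint)
    have "{a..<a + g a} \<inter> {b..<b + g b} = {}" if "a \<in> A" "b \<in> A" "a < b" for a b
      using sep[OF that] by auto
    then show "\<forall>a\<in>A \<inter> {1..N}. \<forall>b\<in>A \<inter> {1..N}. a \<noteq> b \<longrightarrow> {a..<a + g a} \<inter> {b..<b + g b} = {}"
      by (metis Int_commute Int_iff linorder_neqE_nat)
  qed auto
  also have "\<dots> \<le> (\<Sum>a\<in>A \<inter> {1..N}. real (g N) * (1 / real a))"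
  proof (rule sum_mono)
    fix a assume a: "a \<in> A \<inter> {1..N}"
    have "(\<Sum>n\<in>{a..<a + g a}. 1 / real n) \<le> (\<Sum>n\<in>{a..<a + g a}. 1 / real a)"
      using a by (intro sum_mono) (auto intro!: divide_left_mono)
    also have "\<dots> = real (g a) * (1 / real a)" by simp
    also have "\<dots> \<le> real (g N) * (1 / real a)"
      using a monoD[OF mono, of a N] by (intro mult_right_mono) auto
    finally show "(\<Sum>n\<in>{a..<a + g a}. 1 / real n) \<le> real (g N) * (1 / real a)" .
  qed
  finally show ?thesis by (simp add: sum_distrib_left)
qed

text \<open>
  The function \<open>g\<close> is \<open>1 / \<tau>\<close> rounded up, after \<open>\<tau>\<close> has been replaced by its maximum with
  \<open>1 / sqrt (log (n + 3))\<close>. Raising \<open>\<tau>\<close> in this way keeps \<open>g(N)\<close> negligible against \<open>log N\<close>, so that the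
  sum of order \<open>log N / g(N)\<close> obtained from the selected set dominates the bounded error terms even if
  \<open>\<tau>(N) log N\<close> is bounded.
\<close>

lemma exists_gap_function:
  fixes \<tau> :: "nat \<Rightarrow> real"
  assumes anti: "antimono_on {1..} \<tau>" and pos: "\<And>n. n \<ge> 1 \<Longrightarrow> \<tau> n > 0"
    and lim: "\<tau> \<longlonglongrightarrow> 0"
  obtains g :: "nat \<Rightarrow> nat"
  where "mono g" "\<And>n. g n \<ge> 1" "filterlim g at_top sequentially"
    "\<forall>\<^sub>F N in sequentially. real (g N) * \<tau> N \<le> 2"
    "filterlim (\<lambda>N. ln (real N) / real (g N)) at_top sequentially"
proof
  \<comment> \<open>The shift by 3 keeps the square root positive for all \<open>n\<close>, and \<open>max 1 n\<close> below extends \<open>\<tau>\<close>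
     monotonically from \<open>n \<ge> 1\<close> to \<open>n = 0\<close>.\<close>
  let ?r = "\<lambda>n::nat. 1 / sqrt (ln (real n + 3))"
  define \<sigma> where "\<sigma> n = max (\<tau> (max 1 n)) (?r n)" for n
  define g where "g n = nat \<lceil>1 / \<sigma> n\<rceil>" for n
  have \<sigma>_pos: "\<sigma> n > 0" for n
    using pos[of "max 1 n"] by (simp add: \<sigma>_def less_max_iff_disj)
  have \<sigma>_anti: "\<sigma> n \<le> \<sigma> m" if "m \<le> n" for m n
  proof -
    have "\<tau> (max 1 n) \<le> \<tau> (max 1 m)"
      using anti that by (intro monotone_onD[OF anti]) auto
    moreover have "?r n \<le> ?r m"
      using that by (intro divide_left_mono) auto
    ultimately show ?thesis by (auto simp: \<sigma>_def)
  qed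
  show "mono g"
    unfolding g_def using \<sigma>_pos \<sigma>_anti
    by (intro monoI nat_mono ceiling_mono divide_left_mono) auto
  show g1: "g n \<ge> 1" for n
    unfolding g_def using \<sigma>_pos[of n] by (simp add: Suc_le_eq)
  have g_ge: "1 / \<sigma> n \<le> real (g n)" for n
    unfolding g_def by (rule real_nat_ceiling_ge)
  have g_le: "real (g n) \<le> 1 / \<sigma> n + 1" for n
    unfolding g_def using \<sigma>_pos[of n] of_int_ceiling_le_add_one[of "1 / \<sigma> n"] by simp
  have \<sigma>_lim: "\<sigma> \<longlonglongrightarrow> 0"
  proof -
    have "(\<lambda>n. \<tau> (max 1 n)) \<longlonglongrightarrow> 0"
      using lim by (rule Lim_transform_eventually)
        (auto intro!: eventually_mono[OF eventually_ge_at_top[of 1]])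
    moreover have "?r \<longlonglongrightarrow> 0" by real_asymp
    ultimately have "\<sigma> \<longlonglongrightarrow> max 0 0" unfolding \<sigma>_def by (rule tendsto_max)
    then show ?thesis by simp
  qed
  have "filterlim (\<lambda>n. 1 / \<sigma> n) at_top sequentially"
    using filterlim_inverse_at_top[OF \<sigma>_lim] \<sigma>_pos by (simp add: inverse_eq_divide)
  then have "filterlim (\<lambda>n. real (g n)) at_top sequentially"
    by (rule filterlim_at_top_mono) (simp add: g_ge)
  then show "filterlim g at_top sequentially"
    by (simp add: filterlim_sequentially_iff_filterlim_real)
  have "\<forall>\<^sub>F N in sequentially. \<sigma> N < 1" using \<sigma>_lim by (rule order_tendstoD) simp
  then show "\<forall>\<^sub>F N in sequentially. real (g N) * \<tau> N \<le> 2"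
    using eventually_ge_at_top[of 1]
  proof eventually_elim
    case (elim N)
    have "real (g N) * \<tau> N \<le> (1 / \<sigma> N + 1) * \<sigma> N"
      using elim g_le[of N] \<sigma>_pos[of N] pos[of N]
      by (intro mult_mono) (auto simp: \<sigma>_def)
    also have "\<dots> = 1 + \<sigma> N" using \<sigma>_pos[of N] by (simp add: field_simps)
    finally show ?case using elim by simp
  qed
  have g_le': "real (g n) \<le> sqrt (ln (real n + 3)) + 1" for n
  proof -
    have "?r n \<le> \<sigma> n" by (simp add: \<sigma>_def)
    moreover have "?r n > 0" by simp
    ultimately have "1 / \<sigma> n \<le> 1 / ?r n" using \<sigma>_pos[of n] by (intro divide_left_mono mult_pos_pos) auto
    then show ?thesis using g_le[of n] by simp
  qed
  have "filterlim (\<lambda>N. ln (real N) / (sqrt (ln (real N + 3)) + 1)) at_top sequentially"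
    by real_asymp
  then show "filterlim (\<lambda>N. ln (real N) / real (g N)) at_top sequentially"
  proof (rule filterlim_at_top_mono)
    show "\<forall>\<^sub>F N in sequentially. ln (real N) / (sqrt (ln (real N + 3)) + 1) \<le> ln (real N) / real (g N)"
      using eventually_ge_at_top[of 1]
    proof eventually_elim
      case (elim N)
      then show ?case using g_le'[of N] g1[of N] by (intro divide_left_mono mult_pos_pos) auto
    qed
  qed
qed


section \<open>One-sided subshifts\<close>

definition shift :: "(nat \<Rightarrow> 'a) \<Rightarrow> nat \<Rightarrow> 'a" where
  "shift u = (\<lambda>i. u (Suc i))"

text \<open>
  When \<open>x\<close> takes finitely many values this is the closure of the orbit of \<open>x\<close> under the shift; defining
  it by prefixes makes the properties of \<open>x\<close> on finite windows
  pass directly to its points.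
\<close>

definition subshift :: "(nat \<Rightarrow> 'a) \<Rightarrow> (nat \<Rightarrow> 'a) set" where
  "subshift x = {u. \<forall>n. \<exists>m. \<forall>i<n. u i = x (m + i)}"

definition words :: "(nat \<Rightarrow> 'a) \<Rightarrow> nat \<Rightarrow> 'a list set" where
  "words x n = range (\<lambda>m. map (\<lambda>i. x (m + i)) [0..<n])"

lemma funpow_shift: "(shift ^^ n) u = (\<lambda>i. u (n + i))"
  by (induction n) (auto simp: shift_def)

lemma self_in_subshift: "x \<in> subshift x"
  unfolding subshift_def by (auto intro!: exI[of _ 0])

lemma funpow_shift_in_subshift:
  assumes "u \<in> subshift x"
  shows "(shift ^^ n) u \<in> subshift x"
  unfolding subshift_def funpow_shift
proof safe
  fix k
  obtain m where m: "\<forall>i<n + k. u i = x (m + i)" using assms by (auto simp: subshift_def)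
  have "\<forall>i<k. u (n + i) = x (m + n + i)"
  proof safe
    fix i assume "i < k"
    then have "u (n + i) = x (m + (n + i))" using m by auto
    then show "u (n + i) = x (m + n + i)" by (simp add: add.assoc)
  qed
  then show "\<exists>m. \<forall>i<k. u (n + i) = x (m + i)" ..
qed

lemma prefix_in_words:
  assumes "u \<in> subshift x"
  shows "map u [0..<n] \<in> words x n"
proof -
  obtain m where "\<forall>i<n. u i = x (m + i)" using assms by (auto simp: subshift_def)
  then have "map u [0..<n] = map (\<lambda>i. x (m + i)) [0..<n]" by auto
  then show ?thesis by (auto simp: words_def)
qed

lemma subshift_in_range:
  assumes "u \<in> subshift x"
  shows "u i \<in> range x"
proof -
  obtain m where "\<forall>j<Suc i. u j = x (m + j)" using assms unfolding subshift_def by blast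
  then show ?thesis by auto
qed

lemma finite_words:
  assumes "finite (range x)"
  shows "finite (words x n)"
  by (rule finite_subset[OF _ finite_lists_length_eq[OF assms, of n]]) (auto simp: words_def)

text \<open>
  The metric on sequences is a sum over an enumeration of the index set, so the finitely many leading terms
  involve the coordinates \<open>from_nat n\<close> for \<open>n \<le> N\<close>, not those below \<open>N\<close>; \<open>K\<close> exceeds all of them.
\<close>

lemma dist_fun_less_if_agree:
  fixes e :: real
  assumes "e > 0"
  obtains K where "\<And>u v :: nat \<Rightarrow> 'a::metric_space. (\<And>i. i < K \<Longrightarrow> u i = v i) \<Longrightarrow> dist u v < e"
proof -
  obtain N where N: "(1/2::real) ^ N < e"
    using real_arch_pow_inv[OF assms, of "1/2"] by auto
  define K where "K = Suc (Max ((from_nat :: nat \<Rightarrow> nat) ` {..N}))"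
  have "dist u v < e" if "\<And>i. i < K \<Longrightarrow> u i = v i" for u v :: "nat \<Rightarrow> 'a"
  proof -
    have agree: "u (from_nat n) = v (from_nat n)" if "n \<le> N" for n
      using that by (intro \<open>\<And>i. i < K \<Longrightarrow> u i = v i\<close>) (auto simp: K_def less_Suc_eq_le)
    have "{dist (u (from_nat n)) (v (from_nat n)) | n. n \<le> N} = {0}"
      using agree by (auto intro!: exI[of _ 0])
    then have "dist u v \<le> (1/2) ^ N"
      using dist_fun_le_dist_first_terms[of u v N] by simp
    with N show ?thesis by linarith
  qed
  then show thesis by (rule that)
qed

text \<open>
  A closed subset of a product of copies of the finite set \<open>range x\<close>, which is compact by Tychonoff's
  theorem.
\<close>

lemma compact_subshift:
  fixes x :: "nat \<Rightarrow> 'a::metric_space"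
  assumes fin: "finite (range x)"
  shows "compact (subshift x)"
proof -
  let ?P = "PiE UNIV (\<lambda>_::nat. range x)"
  have "compactin (product_topology (\<lambda>_. euclidean) UNIV) ?P"
    unfolding compactin_PiE using fin by (simp add: finite_imp_compact)
  then have P: "compact ?P" by (simp add: euclidean_product_topology)
  have closed: "closed (subshift x)"
  proof (rule closed_sequential_limits[THEN iffD2], safe)
    fix s u assume s: "\<forall>n. s n \<in> subshift x" "s \<longlonglongrightarrow> u"
    show "u \<in> subshift x"
      unfolding subshift_def
    proof safe
      fix k
      have "\<forall>\<^sub>F n in sequentially. s n i = u i" for i
      proof -
        have "(\<lambda>n. s n i) \<longlonglongrightarrow> u i"
          using continuous_on_tendsto_compose[OF continuous_on_product_coordinates s(2)] by simp
        \<comment> \<open>As \<open>range x\<close> is finite, \<open>u i\<close> has a neighbourhood that contains no other value of \<open>x\<close>.\<close>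
        have "finite (range x - {u i})" using fin by auto
        then have "open (- (range x - {u i}))"
          using finite_imp_closed open_Compl by blast
        then have "\<forall>\<^sub>F n in sequentially. s n i \<in> - (range x - {u i})"
          by (rule topological_tendstoD[OF \<open>(\<lambda>n. s n i) \<longlonglongrightarrow> u i\<close>]) auto
        then show ?thesis
          by eventually_elim (use s(1) subshift_in_range in blast)
      qed
      then have "\<forall>\<^sub>F n in sequentially. \<forall>i\<in>{..<k}. s n i = u i"
        by (intro eventually_ball_finite) auto
      then obtain n where "\<forall>i<k. s n i = u i"
        by (auto simp: eventually_sequentially)
      moreover obtain m where "\<forall>i<k. s n i = x (m + i)"
        using s(1) unfolding subshift_def by blast
      ultimately show "\<exists>m. \<forall>i<k. u i = x (m + i)" by metis
    qed
  qed
  have "subshift x \<subseteq> ?P" using subshift_in_range by (auto simp: PiE_def)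
  then show ?thesis using P closed by (metis compact_Int_closed inf.absorb_iff2)
qed

lemma continuous_on_shift:
  "continuous_on S (shift :: (nat \<Rightarrow> 'a::metric_space) \<Rightarrow> nat \<Rightarrow> 'a)"
  unfolding shift_def
  by (intro continuous_on_coordinatewise_then_product)
    (rule continuous_on_subset[OF continuous_on_product_coordinates], auto)

abbreviation subshift_metric :: "(nat \<Rightarrow> 'a::metric_space) \<Rightarrow> (nat \<Rightarrow> 'a) metric" where
  "subshift_metric x \<equiv> submetric euclidean_metric (subshift x)"

lemma topological_dynamical_system_subshift:
  fixes x :: "nat \<Rightarrow> 'a::metric_space"
  assumes "finite (range x)"
  shows "topological_dynamical_system (subshift_metric x) shift"
proof -
  have "shift u \<in> subshift x" if "u \<in> subshift x" for u
    using funpow_shift_in_subshift[OF that, of 1] by simp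
  then show ?thesis
    unfolding topological_dynamical_system_def mtopology_of_submetric
    using compact_subshift[OF assms]
    by (auto simp: continuous_map_in_subtopology continuous_on_shift compact_space_subtopology)
qed

text \<open>
  If two points share a prefix of length \<open>n + K\<close>, then their first \<open>n\<close> shifts agree on \<open>K\<close> coordinates and
  hence are \<open>e\<close>-close. One representative for each prefix thus gives a spanning set.
\<close>

lemma spanning_number_subshift_le:
  fixes x :: "nat \<Rightarrow> 'a::metric_space"
  assumes fin: "finite (range x)" and e: "e > 0"
  obtains K where "\<And>n. spanning_number (subshift_metric x) shift n e \<le> card (words x (n + K))"
proof -
  obtain K where K: "\<And>u v :: nat \<Rightarrow> 'a. (\<And>i. i < K \<Longrightarrow> u i = v i) \<Longrightarrow> dist u v < e"
    using dist_fun_less_if_agree[OF e] by blast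
  have "spanning_number (subshift_metric x) shift n e \<le> card (words x (n + K))" for n
  proof -
    let ?pre = "\<lambda>u. map u [0..<n + K]"
    let ?rep = "inv_into (subshift x) ?pre"
    define E where "E = ?rep ` ?pre ` subshift x"
    have sub: "?pre ` subshift x \<subseteq> words x (n + K)" using prefix_in_words by blast
    then have finE: "finite (?pre ` subshift x)"
      using finite_words[OF fin] by (rule finite_subset)
    have "spanning_set (subshift_metric x) shift n e E"
      unfolding spanning_set_def
    proof (intro conjI ballI)
      show "E \<subseteq> mspace (subshift_metric x)"
        unfolding E_def by (auto intro!: inv_into_into)
    next
      fix u assume "u \<in> mspace (subshift_metric x)"
      then have u: "u \<in> subshift x" by simp
      let ?v = "?rep (?pre u)"
      have "?pre ?v = ?pre u" using u f_inv_into_f[of "?pre u" ?pre "subshift x"] by blast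
      then have agree: "u j = ?v j" if "j < n + K" for j using that by auto
      have "dist ((shift ^^ i) u) ((shift ^^ i) ?v) < e" if "i < n" for i
        using that by (intro K) (auto simp: funpow_shift intro: agree)
      then show "\<exists>v\<in>E. \<forall>i<n. mdist (subshift_metric x) ((shift ^^ i) u) ((shift ^^ i) v) < e"
        using u by (intro bexI[of _ ?v]) (auto simp: E_def)
    qed
    then have "spanning_number (subshift_metric x) shift n e \<le> card E"
      unfolding spanning_number_def using finE by (intro cInf_lower) (auto simp: E_def)
    also have "\<dots> \<le> card (?pre ` subshift x)" unfolding E_def by (rule card_image_le[OF finE])
    also have "\<dots> \<le> card (words x (n + K))" by (intro card_mono finite_words fin sub)
    finally show ?thesis .
  qed
  then show thesis by (rule that)
qed

lemma ln_of_nat_nonneg: "0 \<le> ln (real n)"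
  by (cases "n = 0") auto

lemma ln_of_nat_mono: "m \<le> n \<Longrightarrow> ln (real m) \<le> ln (real n)"
  by (cases "m = 0") (auto simp: ln_of_nat_nonneg)

text \<open>
  For fixed \<open>e\<close> the offset \<open>K\<close> in the bound of the spanning numbers by word counts is constant, so it
  disappears after division by \<open>n\<close>.
\<close>

lemma topological_entropy_subshift_eq_0:
  fixes x :: "nat \<Rightarrow> 'a::metric_space"
  assumes fin: "finite (range x)"
    and words: "(\<lambda>n. ln (real (card (words x n))) / real n) \<longlonglongrightarrow> 0"
  shows "topological_entropy (subshift_metric x) shift = 0"
proof -
  have "limsup (\<lambda>n. ereal (ln (real (spanning_number (subshift_metric x) shift n e)) / real n)) = 0"
    if e: "e > 0" for e
  proof -
    let ?s = "\<lambda>n. spanning_number (subshift_metric x) shift n e"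
    obtain K where K: "\<And>n. ?s n \<le> card (words x (n + K))"
      using spanning_number_subshift_le[OF fin e] by blast
    have "(\<lambda>n. ln (real (card (words x (n + K)))) / real (n + K)) \<longlonglongrightarrow> 0"
      using words by (rule LIMSEQ_ignore_initial_segment)
    moreover have "(\<lambda>n. real (n + K) / real n) \<longlonglongrightarrow> 1" by real_asymp
    ultimately have "(\<lambda>n. ln (real (card (words x (n + K)))) / real (n + K) * (real (n + K) / real n)) \<longlonglongrightarrow> 0 * 1"
      by (rule tendsto_mult)
    then have lim: "(\<lambda>n. ln (real (card (words x (n + K)))) / real (n + K) * (real (n + K) / real n)) \<longlonglongrightarrow> 0"
      by simp
    have "(\<lambda>n. ln (real (?s n)) / real n) \<longlonglongrightarrow> 0"
    proof (rule tendsto_sandwich[OF _ _ tendsto_const lim])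
      show "\<forall>\<^sub>F n in sequentially. 0 \<le> ln (real (?s n)) / real n"
        by (intro always_eventually allI divide_nonneg_nonneg ln_of_nat_nonneg) auto
      show "\<forall>\<^sub>F n in sequentially. ln (real (?s n)) / real n \<le>
          ln (real (card (words x (n + K)))) / real (n + K) * (real (n + K) / real n)"
        using eventually_gt_at_top[of 0]
      proof eventually_elim
        case (elim n)
        then show ?case using ln_of_nat_mono[OF K[of n]] by (simp add: divide_right_mono)
      qed
    qed
    then have "(\<lambda>n. ereal (ln (real (?s n)) / real n)) \<longlonglongrightarrow> 0"
      by (simp add: zero_ereal_def)
    then show ?thesis by (intro lim_imp_Limsup) auto
  qed
  then have "topological_entropy (subshift_metric x) shift = (SUP e\<in>{0::real<..}. 0)"
    unfolding topological_entropy_def by (intro SUP_cong) auto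
  also have "\<dots> = 0" by (intro SUP_const) (auto intro: exI[of _ 1])
  finally show ?thesis .
qed


section \<open>Sign sequences of sets with growing gaps\<close>

definition signs :: "nat set \<Rightarrow> nat \<Rightarrow> real" where
  "signs A n = (if n \<in> A then - 1 else 1)"

lemma finite_range_signs: "finite (range (signs A))"
  by (rule finite_subset[of _ "{- 1, 1}"]) (auto simp: signs_def)

text \<open>
  The gaps of a set \<open>A\<close> may be short at the beginning, so that only words of \<open>signs A\<close> starting late can be
  counted by means of the gaps.
\<close>

definition late_words :: "(nat \<Rightarrow> 'a) \<Rightarrow> nat \<Rightarrow> nat \<Rightarrow> 'a list set" where
  "late_words x m n = (\<lambda>k. map (\<lambda>i. x (k + i)) [0..<n]) ` {m..}"

lemma finite_late_words_signs: "finite (late_words (signs A) m n)"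
  by (rule finite_subset[OF _ finite_words[OF finite_range_signs, of A n]])
    (auto simp: late_words_def words_def)

text \<open>
  A late window of length \<open>L\<close> contains at most one \<open>-1\<close>. It is determined by the position \<open>j < L\<close> of this
  entry, or by \<open>j = L\<close> if there is none.
\<close>

lemma card_late_words_signs_one_block:
  assumes sep: "separated_from m L A"
  shows "card (late_words (signs A) m L) \<le> Suc L"
proof -
  let ?w = "\<lambda>j. map (\<lambda>i. if i = j then - 1 else 1 :: real) [0..<L]"
  have "late_words (signs A) m L \<subseteq> ?w ` {..L}"
  proof
    fix w assume "w \<in> late_words (signs A) m L"
    then obtain k where k: "k \<ge> m" and w: "w = map (\<lambda>i. signs A (k + i)) [0..<L]"
      by (auto simp: late_words_def)
    show "w \<in> ?w ` {..L}"
    proof (cases "\<exists>j<L. k + j \<in> A")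
      case True
      then obtain j where j: "j < L" "k + j \<in> A" by blast
      have not_less: "\<not> a < b" if "a < L" "k + a \<in> A" "b < L" "k + b \<in> A" for a b
      proof
        assume "a < b"
        then have "m \<le> k + a" "k + a < k + b" using k by auto
        then have "k + a + L \<le> k + b"
          using sep that unfolding separated_from_def by blast
        then show False using that by simp
      qed
      have "k + i \<in> A \<longleftrightarrow> i = j" if "i < L" for i
        using not_less[of i j] not_less[of j i] j that by (meson linorder_neqE_nat)
      then have "w = ?w j" unfolding w by (intro map_cong refl) (simp add: signs_def)
      then show ?thesis using j by auto
    next
      case False
      then have "w = ?w L" by (auto simp: w signs_def)
      then show ?thesis by auto
    qed
  qed
  then have "card (late_words (signs A) m L) \<le> card (?w ` {..L})"
    by (intro card_mono) auto
  also have "\<dots> \<le> card {..L}" by (rule card_image_le) simp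
  finally show ?thesis by simp
qed

lemma card_late_words_signs_blocks:
  assumes sep: "separated_from m L A"
  shows "card (late_words (signs A) m (q * L)) \<le> Suc L ^ q"
proof (induction q)
  case 0
  have "late_words (signs A) m 0 = {[]}" by (auto simp: late_words_def)
  then show ?case by simp
next
  case (Suc q)
  let ?W = "late_words (signs A) m"
  have "?W (Suc q * L) \<subseteq> (\<lambda>(v, w). v @ w) ` (?W L \<times> ?W (q * L))"
  proof
    fix w assume "w \<in> ?W (Suc q * L)"
    then obtain k where k: "k \<ge> m" and w: "w = map (\<lambda>i. signs A (k + i)) [0..<L + q * L]"
      by (auto simp: late_words_def)
    have "w = map (\<lambda>i. signs A (k + i)) [0..<L] @ map (\<lambda>i. signs A (k + L + i)) [0..<q * L]"
      unfolding w by (rule nth_equalityI) (auto simp: nth_append add.assoc)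
    moreover have "map (\<lambda>i. signs A (k + L + i)) [0..<q * L] \<in> ?W (q * L)"
      unfolding late_words_def using k by (intro image_eqI[of _ _ "k + L"]) auto
    moreover have "map (\<lambda>i. signs A (k + i)) [0..<L] \<in> ?W L"
      unfolding late_words_def using k by (intro image_eqI[of _ _ k]) auto
    ultimately show "w \<in> (\<lambda>(v, w). v @ w) ` (?W L \<times> ?W (q * L))" by blast
  qed
  then have "card (?W (Suc q * L)) \<le> card ((\<lambda>(v, w). v @ w) ` (?W L \<times> ?W (q * L)))"
    by (intro card_mono finite_imageI finite_cartesian_product finite_late_words_signs)
  also have "\<dots> \<le> card (?W L \<times> ?W (q * L))"
    by (intro card_image_le finite_cartesian_product finite_late_words_signs)
  also have "\<dots> \<le> Suc L * Suc L ^ q"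
    unfolding card_cartesian_product
    by (intro mult_le_mono Suc.IH card_late_words_signs_one_block sep)
  finally show ?case by simp
qed

text \<open>
  At most \<open>m\<close> words start before position \<open>m\<close>, and a late word is a prefix of a concatenation of \<open>q\<close> blocks
  of length \<open>L\<close>.
\<close>

lemma card_words_signs_le:
  assumes sep: "separated_from m L A" and n: "n \<le> q * L"
  shows "card (words (signs A) n) \<le> Suc m * Suc L ^ q"
proof -
  let ?w = "\<lambda>n k. map (\<lambda>i. signs A (k + i)) [0..<n]"
  have "late_words (signs A) m n \<subseteq> take n ` late_words (signs A) m (q * L)"
  proof
    fix w assume "w \<in> late_words (signs A) m n"
    then obtain k where k: "k \<ge> m" "w = ?w n k" by (auto simp: late_words_def)
    then have "w = take n (?w (q * L) k)" using n by (simp add: take_map)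
    then show "w \<in> take n ` late_words (signs A) m (q * L)" using k by (auto simp: late_words_def)
  qed
  then have "card (late_words (signs A) m n) \<le> card (late_words (signs A) m (q * L))"
    by (rule surj_card_le[OF finite_late_words_signs])
  then have late: "card (late_words (signs A) m n) \<le> Suc L ^ q"
    using card_late_words_signs_blocks[OF sep, of q] by linarith
  have "words (signs A) n \<subseteq> ?w n ` {..<m} \<union> late_words (signs A) m n"
    unfolding words_def late_words_def by (auto simp: image_iff) (metis atLeast_iff lessThan_iff not_le)
  then have "card (words (signs A) n) \<le> card (?w n ` {..<m} \<union> late_words (signs A) m n)"
    by (intro card_mono) (auto intro: finite_late_words_signs)
  also have "\<dots> \<le> card (?w n ` {..<m}) + card (late_words (signs A) m n)"
    by (rule card_Un_le)
  also have "\<dots> \<le> m + Suc L ^ q"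
    using card_image_le[of "{..<m}" "?w n"] late by simp
  also have "\<dots> \<le> Suc m * Suc L ^ q" by simp
  finally show ?thesis .
qed

text \<open>
  With blocks of length \<open>L\<close> the exponential growth rate of the number of words is at most \<open>log (L + 1) / L\<close>,
  and \<open>L\<close> is arbitrary.
\<close>

lemma words_signs_subexponential:
  assumes "gaps_tend_to_infinity A"
  shows "(\<lambda>n. ln (real (card (words (signs A) n))) / real n) \<longlonglongrightarrow> 0"
proof (rule order_tendstoI)
  fix e :: real assume "e < 0"
  then show "\<forall>\<^sub>F n in sequentially. e < ln (real (card (words (signs A) n))) / real n"
    by (intro always_eventually allI less_le_trans[OF \<open>e < 0\<close>] divide_nonneg_nonneg ln_of_nat_nonneg) auto
next
  fix e :: real assume e: "0 < e"
  have "((\<lambda>L. ln (1 + real L) / real L) \<longlongrightarrow> 0) sequentially" by real_asymp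
  then have "\<forall>\<^sub>F L in sequentially. ln (1 + real L) / real L < e" using e by (rule order_tendstoD)
  then have "\<forall>\<^sub>F L in sequentially. ln (1 + real L) / real L < e \<and> L > 0"
    using eventually_gt_at_top[of 0] by eventually_elim auto
  then obtain L where L: "ln (1 + real L) / real L < e" "L > 0"
    by (auto simp: eventually_sequentially)
  obtain m where m: "separated_from m L A"
    using assms by (auto simp: gaps_tend_to_infinity_def)
  let ?b = "\<lambda>n. (ln (1 + real m) + (real n / real L + 1) * ln (1 + real L)) / real n"
  have "(?b \<longlongrightarrow> ln (1 + real L) / real L) sequentially"
    using L(2) by (real_asymp simp: field_simps)
  then have "\<forall>\<^sub>F n in sequentially. ?b n < e" using L(1) by (rule order_tendstoD)
  then show "\<forall>\<^sub>F n in sequentially. ln (real (card (words (signs A) n))) / real n < e"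
    using eventually_gt_at_top[of 0]
  proof eventually_elim
    case (elim n)
    define q where "q = n div L + 1"
    have "n \<le> q * L"
      using dividend_less_div_times[OF L(2), of n] by (simp add: q_def)
    then have "ln (real (card (words (signs A) n))) \<le> ln (real (Suc m * Suc L ^ q))"
      by (intro ln_of_nat_mono card_words_signs_le m)
    also have "\<dots> = ln (1 + real m) + real q * ln (1 + real L)"
      by (simp only: of_nat_mult of_nat_power of_nat_Suc)
        (subst ln_mult, auto simp: ln_realpow)
    also have "\<dots> \<le> ln (1 + real m) + (real n / real L + 1) * ln (1 + real L)"
      using of_nat_div_le_of_nat[of n L, where 'a = real] by (intro add_left_mono mult_right_mono) (auto simp: q_def)
    finally have "ln (real (card (words (signs A) n))) / real n \<le> ?b n"
      by (intro divide_right_mono) auto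
    then show ?case using elim by linarith
  qed
qed

text \<open>
  A prefix of \<open>u\<close> is a window of \<open>signs A\<close> starting at some \<open>k\<close>. The entries \<open>-1\<close> from position \<open>m\<close> on sit in
  \<open>A\<close> at positions \<open>k + m\<close> or later, so the threshold \<open>m\<close> that is valid for \<open>A\<close> is valid for \<open>u\<close>,
  whatever the value of \<open>k\<close>.
\<close>

lemma subshift_signs_gaps_tend_to_infinity:
  assumes gaps: "gaps_tend_to_infinity A" and u: "u \<in> subshift (signs A)"
  shows "gaps_tend_to_infinity {n. u n \<noteq> 1}"
  unfolding gaps_tend_to_infinity_def
proof
  fix L
  obtain m where m: "separated_from m L A"
    using gaps by (auto simp: gaps_tend_to_infinity_def)
  have "separated_from m L {n. u n \<noteq> 1}"
    unfolding separated_from_def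
  proof (intro ballI impI)
    fix a b assume ab: "a \<in> {n. u n \<noteq> 1}" "b \<in> {n. u n \<noteq> 1}" "m \<le> a" "a < b"
    obtain k where k: "\<forall>i<Suc b. u i = signs A (k + i)"
      using u unfolding subshift_def by blast
    have "k + a \<in> A" "k + b \<in> A" using k ab by (auto simp: signs_def split: if_splits)
    moreover have "m \<le> k + a" "k + a < k + b" using ab by auto
    ultimately have "k + a + L \<le> k + b" using m unfolding separated_from_def by blast
    then show "a + L \<le> b" by simp
  qed
  then show "\<exists>m. separated_from m L {n. u n \<noteq> 1}" ..
qed

text \<open>
  Just after a late element of \<open>A\<close>, or beyond the last element, there are arbitrarily long windows
  without any.
\<close>

lemma const_1_in_subshift_signs:
  assumes "gaps_tend_to_infinity A"
  shows "(\<lambda>_. 1) \<in> subshift (signs A)"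
  unfolding subshift_def
proof safe
  fix n
  obtain m where m: "separated_from m (Suc n) A"
    using assms by (auto simp: gaps_tend_to_infinity_def)
  show "\<exists>m. \<forall>i<n. 1 = signs A (m + i)"
  proof (cases "\<exists>a\<in>A. m \<le> a")
    case True
    then obtain a where a: "a \<in> A" "m \<le> a" by blast
    have "Suc a + i \<notin> A" if "i < n" for i
      using m a that by (force simp: separated_from_def)
    then show ?thesis by (intro exI[of _ "Suc a"]) (auto simp: signs_def)
  next
    case False
    then show ?thesis by (intro exI[of _ m]) (auto simp: signs_def)
  qed
qed

text \<open>
  By continuity at the constant sequence 1, the values \<open>f ((shift ^^ n) u)\<close> differ from \<open>f 1\<close> by less than \<open>e / 2\<close>
  unless a \<open>-1\<close> occurs in \<open>u\<close> within \<open>K\<close> places from \<open>n\<close>. These exceptional times, the set \<open>E\<close> below, have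
  logarithmic density 0. The remaining main term is \<open>f 1 * \<Sum> \<mu>(n) / n\<close>, which is bounded.
\<close>

lemma log_averaged_moebius_disjointness:
  fixes f :: "(nat \<Rightarrow> real) \<Rightarrow> complex"
  assumes gaps: "gaps_tend_to_infinity A"
    and f: "continuous_on (subshift (signs A)) f" and u: "u \<in> subshift (signs A)"
  shows "(\<lambda>N. of_real (1 / ln (real N)) *
      (\<Sum>n=1..N. of_int (moebius_mu n) * f ((shift ^^ n) u) / of_nat n)) \<longlonglongrightarrow> 0"
proof (rule tendstoI)
  fix e :: real assume "e > 0"
  then have e: "e / 2 > 0" by simp
  let ?X = "subshift (signs A)" and ?one = "\<lambda>_::nat. 1::real"
  have one: "?one \<in> ?X" using const_1_in_subshift_signs[OF gaps] .
  obtain d where d: "d > 0" "\<And>v. v \<in> ?X \<Longrightarrow> dist v ?one < d \<Longrightarrow> dist (f v) (f ?one) < e / 2"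
    using f one e unfolding continuous_on_iff by meson
  obtain K where K: "\<And>u v :: nat \<Rightarrow> real. (\<And>i. i < K \<Longrightarrow> u i = v i) \<Longrightarrow> dist u v < d"
    using dist_fun_less_if_agree[OF d(1)] by blast
  have "bounded (f ` ?X)"
    using compact_imp_bounded compact_continuous_image f compact_subshift[OF finite_range_signs] by blast
  then obtain B where B: "\<And>v. v \<in> ?X \<Longrightarrow> norm (f v) \<le> B"
    unfolding bounded_iff by auto
  have B0: "B \<ge> 0" using B[OF one] norm_ge_zero order_trans by blast
  define E where "E = {n. \<exists>i<K. n + i \<in> {n. u n \<noteq> 1}}"
  have E: "(\<lambda>N. (\<Sum>n\<in>E \<inter> {1..N}. 1 / real n) / ln (real N)) \<longlonglongrightarrow> 0"
    unfolding E_def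
    by (intro log_density_zero_window_meets subshift_signs_gaps_tend_to_infinity[OF gaps u])
  let ?g = "\<lambda>n. f ((shift ^^ n) u) - f ?one"
  have g: "norm (?g n) \<le> e / 2 + (if n \<in> E then 2 * B else 0)" for n
  proof (cases "n \<in> E")
    case True
    have "norm (?g n) \<le> B + B"
      by (intro order_trans[OF norm_triangle_ineq4] add_mono B one funpow_shift_in_subshift u)
    then show ?thesis using e True by simp
  next
    case False
    then have "dist ((shift ^^ n) u) ?one < d"
      by (intro K) (auto simp: E_def funpow_shift)
    then have "dist (f ((shift ^^ n) u)) (f ?one) < e / 2"
      by (intro d(2) funpow_shift_in_subshift u)
    then show ?thesis using False by (simp add: dist_norm)
  qed
  have bound: "norm (\<Sum>n=1..N. of_int (moebius_mu n) * f ((shift ^^ n) u) / of_nat n) \<le>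
      2 * B + e / 2 * harm N + 2 * B * (\<Sum>n\<in>E \<inter> {1..N}. 1 / real n)" for N
  proof -
    let ?M = "\<Sum>n=1..N. real_of_int (moebius_mu n) / real n"
    have "(\<Sum>n=1..N. of_int (moebius_mu n) * f ((shift ^^ n) u) / of_nat n) =
        of_real ?M * f ?one + (\<Sum>n=1..N. of_int (moebius_mu n) * ?g n / of_nat n)"
      unfolding of_real_sum sum_distrib_right sum.distrib[symmetric]
      by (intro sum.cong) (auto simp: algebra_simps diff_divide_distrib)
    also have "norm \<dots> \<le> \<bar>?M\<bar> * norm (f ?one) + (\<Sum>n=1..N. norm (of_int (moebius_mu n) * ?g n / of_nat n))"
      by (rule order_trans[OF norm_triangle_ineq add_mono]) (auto simp: norm_mult intro: norm_sum simp del: of_real_sum)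
    also have "\<dots> \<le> 2 * B + (\<Sum>n=1..N. (e / 2 + (if n \<in> E then 2 * B else 0)) / real n)"
    proof (intro add_mono mult_mono sum_mono)
      fix n assume "n \<in> {1..N}"
      have "\<bar>real_of_int (moebius_mu n)\<bar> \<le> 1" using abs_moebius_mu_le[of n] by linarith
      then have "norm (of_int (moebius_mu n) * ?g n) \<le> 1 * norm (?g n)"
        unfolding norm_mult by (intro mult_right_mono) auto
      then have "norm (of_int (moebius_mu n) * ?g n) \<le> e / 2 + (if n \<in> E then 2 * B else 0)"
        using g[of n] by linarith
      then show "norm (of_int (moebius_mu n) * ?g n / of_nat n) \<le>
          (e / 2 + (if n \<in> E then 2 * B else 0)) / real n"
        unfolding norm_divide norm_of_nat by (intro divide_right_mono) auto
    qed (use B[OF one] abs_sum_moebius_mu_over_n_le[of N] in auto)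
    also have "(\<Sum>n=1..N. (e / 2 + (if n \<in> E then 2 * B else 0)) / real n) =
        (\<Sum>n=1..N. e / 2 * (1 / real n)) + (\<Sum>n=1..N. if n \<in> E then 2 * B * (1 / real n) else 0)"
      unfolding sum.distrib[symmetric] by (intro sum.cong) (auto simp: add_divide_distrib)
    also have "(\<Sum>n=1..N. e / 2 * (1 / real n)) = e / 2 * harm N"
      by (simp only: sum_distrib_left harm_def inverse_eq_divide)
    also have "(\<Sum>n=1..N. if n \<in> E then 2 * B * (1 / real n) else 0) =
        (\<Sum>n\<in>E \<inter> {1..N}. 2 * B * (1 / real n))"
      by (intro sum.mono_neutral_cong_right) auto
    finally show ?thesis by (simp add: sum_distrib_left)
  qed
  let ?S = "\<lambda>N. (\<Sum>n\<in>E \<inter> {1..N}. 1 / real n) / ln (real N)"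
  have "((\<lambda>N. (2 * B + e / 2 * (ln (real N) + 1)) / ln (real N)) \<longlongrightarrow> e / 2) sequentially"
    by real_asymp
  moreover have "(\<lambda>N. 2 * B * ?S N) \<longlonglongrightarrow> 2 * B * 0"
    by (intro tendsto_intros E)
  ultimately have "(\<lambda>N. (2 * B + e / 2 * (ln (real N) + 1)) / ln (real N) + 2 * B * ?S N) \<longlonglongrightarrow> e / 2 + 2 * B * 0"
    by (rule tendsto_add)
  then have "\<forall>\<^sub>F N in sequentially. (2 * B + e / 2 * (ln (real N) + 1)) / ln (real N) + 2 * B * ?S N < e"
    by (rule order_tendstoD) (use \<open>e > 0\<close> in simp)
  then show "\<forall>\<^sub>F N in sequentially. dist (of_real (1 / ln (real N)) *
      (\<Sum>n=1..N. of_int (moebius_mu n) * f ((shift ^^ n) u) / of_nat n)) 0 < e"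
    using eventually_ge_at_top[of 2]
  proof eventually_elim
    case (elim N)
    let ?T = "\<Sum>n=1..N. of_int (moebius_mu n) * f ((shift ^^ n) u) / of_nat n"
    have ln: "ln (real N) > 0" using elim by simp
    have "norm (of_real (1 / ln (real N)) * ?T) = norm ?T / ln (real N)"
      using ln by (simp add: norm_mult norm_divide)
    also have "\<dots> \<le> (2 * B + e / 2 * harm N + 2 * B * (\<Sum>n\<in>E \<inter> {1..N}. 1 / real n)) / ln (real N)"
      using ln by (intro divide_right_mono bound) auto
    also have "\<dots> \<le> (2 * B + e / 2 * (ln (real N) + 1) + 2 * B * (\<Sum>n\<in>E \<inter> {1..N}. 1 / real n)) / ln (real N)"
      using ln e B0 elim harm_le_ln_plus_one[of N]
      by (intro divide_right_mono add_mono mult_left_mono) auto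
    also have "\<dots> = (2 * B + e / 2 * (ln (real N) + 1)) / ln (real N) + 2 * B * ?S N"
      by (simp add: add_divide_distrib)
    also have "\<dots> < e" using elim by simp
    finally show ?case by simp
  qed
qed

section \<open>The system\<close>

theorem theorem1p1:
  fixes \<tau> :: "nat \<Rightarrow> real"
  assumes "antimono_on {1..} \<tau>"
    and "\<And>n. n \<ge> 1 \<Longrightarrow> \<tau> n > 0"
    and "\<tau> \<longlonglongrightarrow> 0"
  shows "\<exists>(X :: (nat \<Rightarrow> real) metric) (T :: (nat \<Rightarrow> real) \<Rightarrow> (nat \<Rightarrow> real)).
    topological_dynamical_system X T \<and>
    topological_entropy X T = 0 \<and>
    (\<exists>x\<in>mspace X. \<exists>f :: (nat \<Rightarrow> real) \<Rightarrow> real.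
       continuous_map (mtopology_of X) euclidean f \<and>
       (\<forall>y\<in>mspace X. \<bar>f y\<bar> = 1) \<and>
       liminf (\<lambda>N. ereal (1 / (ln (real N) * \<tau> N) *
         (\<Sum>n=1..N. of_int (moebius_mu n) * f ((T ^^ n) x) / real n))) > 0) \<and>
    (\<forall>f :: (nat \<Rightarrow> real) \<Rightarrow> complex. continuous_map (mtopology_of X) euclidean f \<longrightarrow>
       (\<forall>x\<in>mspace X.
         (\<lambda>N. of_real (1 / ln (real N)) *
           (\<Sum>n=1..N. of_int (moebius_mu n) * f ((T ^^ n) x) / of_nat n)) \<longlonglongrightarrow> 0))"
proof -
  obtain g :: "nat \<Rightarrow> nat" where g: "mono g" "\<And>n. g n \<ge> 1" "filterlim g at_top sequentially"
    and g_\<tau>: "\<forall>\<^sub>F N in sequentially. real (g N) * \<tau> N \<le> 2"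
    and g_ln: "filterlim (\<lambda>N. ln (real N) / real (g N)) at_top sequentially"
    using exists_gap_function[OF assms] by blast
  define P where "P = {n. moebius_mu n = - 1}"
  obtain A where AP: "A \<subseteq> P" and sep: "\<And>a b. a \<in> A \<Longrightarrow> b \<in> A \<Longrightarrow> a < b \<Longrightarrow> a + g a \<le> b"
    and cover: "\<And>n. n \<in> P \<Longrightarrow> \<exists>a\<in>A. a \<le> n \<and> n < a + g a"
    using greedy_subset[of g P] g(2) by blast
  have gaps: "gaps_tend_to_infinity A"
    unfolding gaps_tend_to_infinity_def
  proof
    fix L
    obtain m where m: "g m \<ge> L"
      using g(3) by (auto simp: filterlim_at_top eventually_sequentially)
    have "separated_from m L A"
      unfolding separated_from_def
    proof (intro ballI impI)
      fix a b assume "a \<in> A" "b \<in> A" "m \<le> a" "a < b"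
      then show "a + L \<le> b" using sep[of a b] m monoD[OF g(1), of m a] by linarith
    qed
    then show "\<exists>m. separated_from m L A" ..
  qed
  let ?x = "signs A" and ?X = "subshift_metric (signs A)" and ?f = "\<lambda>u::nat \<Rightarrow> real. u 0"
  have top: "mtopology_of ?X = top_of_set (subshift ?x)"
    by (simp add: mtopology_of_submetric)
  \<comment> \<open>On \<open>A\<close> the summand is \<open>1 / n = \<mu>(n) / n + 2 / n\<close>, and \<open>A\<close> retains at least a proportion \<open>1 / g(N)\<close> of
     the logarithmic sum over \<open>P\<close>.\<close>
  have sum_ge: "ln (real N) / (2 * real (g N)) - 4 \<le>
      (\<Sum>n=1..N. of_int (moebius_mu n) * ?f ((shift ^^ n) ?x) / real n)" if "N \<ge> 1" for N
  proof -
    let ?M = "\<Sum>n=1..N. real_of_int (moebius_mu n) / real n"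
    let ?S = "\<Sum>a\<in>A \<inter> {1..N}. 1 / real a"
    have "(\<Sum>n=1..N. of_int (moebius_mu n) * ?f ((shift ^^ n) ?x) / real n) =
        (\<Sum>n=1..N. real_of_int (moebius_mu n) / real n + (if n \<in> A then 2 * (1 / real n) else 0))"
      using AP by (intro sum.cong) (auto simp: funpow_shift signs_def P_def)
    also have "\<dots> = ?M + (\<Sum>n=1..N. if n \<in> A then 2 * (1 / real n) else 0)"
      by (rule sum.distrib)
    also have "(\<Sum>n=1..N. if n \<in> A then 2 * (1 / real n) else 0) = (\<Sum>a\<in>A \<inter> {1..N}. 2 * (1 / real a))"
      by (intro sum.mono_neutral_cong_right) auto
    also have "\<dots> = 2 * ?S" by (simp only: sum_distrib_left)
    finally have eq: "(\<Sum>n=1..N. of_int (moebius_mu n) * ?f ((shift ^^ n) ?x) / real n) = ?M + 2 * ?S" .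
    have "ln (real N) / 4 - 1 \<le> harm N / 4 - 1"
      using harm_ge_ln[of N] ln_of_nat_mono[of N "N + 1"] by (simp add: add_ac)
    also have "\<dots> \<le> (\<Sum>n\<in>P \<inter> {1..N}. 1 / real n)"
      using sum_moebius_mu_minus_one_ge[of N] by (simp add: P_def Int_def conj_commute)
    also have "\<dots> \<le> real (g N) * ?S"
      by (rule sum_reciprocals_le_times_greedy[OF g(1) _ AP sep cover]) (auto simp: P_def moebius_mu_def)
    finally have "ln (real N) / 2 - 2 \<le> 2 * (real (g N) * ?S)" by simp
    moreover have "real (g N) \<ge> 1" using g(2)[of N] by simp
    ultimately have "ln (real N) / 2 \<le> real (g N) * (2 * ?S + 2)"
      by (simp add: algebra_simps)
    then have "ln (real N) / (2 * real (g N)) \<le> 2 * ?S + 2"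
      using \<open>real (g N) \<ge> 1\<close> by (simp add: field_simps)
    then show ?thesis
      using eq abs_sum_moebius_mu_over_n_le[of N] by linarith
  qed
  \<comment> \<open>With \<open>t = log N / g(N)\<close>, the bound \<open>t / 2 - 4\<close> above is at least \<open>t / 4\<close> once \<open>t \<ge> 16\<close>, and
     \<open>g(N) \<tau>(N) \<le> 2\<close> makes \<open>t / 4\<close> at least \<open>\<tau>(N) log N / 8\<close>.\<close>
  have "\<forall>\<^sub>F N in sequentially. 16 \<le> ln (real N) / real (g N)"
    using g_ln by (simp add: filterlim_at_top)
  then have "\<forall>\<^sub>F N in sequentially. ereal (1 / 8) \<le> ereal (1 / (ln (real N) * \<tau> N) *
      (\<Sum>n=1..N. of_int (moebius_mu n) * ?f ((shift ^^ n) ?x) / real n))"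
    using g_\<tau> eventually_ge_at_top[of 2]
  proof eventually_elim
    case (elim N)
    let ?T = "\<Sum>n=1..N. of_int (moebius_mu n) * ?f ((shift ^^ n) ?x) / real n"
    have ln: "ln (real N) > 0" and \<tau>: "\<tau> N > 0" and gN: "real (g N) \<ge> 1"
      using elim assms(2)[of N] g(2)[of N] by auto
    have "ln (real N) * \<tau> N \<le> ln (real N) * (2 / real (g N))"
      using elim ln gN by (intro mult_left_mono) (auto simp: field_simps)
    then have "1 / 8 * (ln (real N) * \<tau> N) \<le> ln (real N) / real (g N) / 4" by (simp add: mult.commute)
    also have "\<dots> \<le> ln (real N) / (2 * real (g N)) - 4" using elim by simp
    also have "\<dots> \<le> ?T" using sum_ge elim by simp
    finally show ?case using ln \<tau> by (simp add: field_simps)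
  qed
  then have "ereal (1 / 8) \<le> liminf (\<lambda>N. ereal (1 / (ln (real N) * \<tau> N) *
      (\<Sum>n=1..N. of_int (moebius_mu n) * ?f ((shift ^^ n) ?x) / real n)))"
    by (rule Liminf_bounded)
  then have liminf: "liminf (\<lambda>N. ereal (1 / (ln (real N) * \<tau> N) *
      (\<Sum>n=1..N. of_int (moebius_mu n) * ?f ((shift ^^ n) ?x) / real n))) > 0"
    by (rule less_le_trans[rotated]) simp
  have f: "continuous_map (mtopology_of ?X) euclidean ?f"
    unfolding top by (simp add: continuous_on_subset[OF continuous_on_product_coordinates])
  have f_abs: "\<forall>y\<in>mspace ?X. \<bar>?f y\<bar> = 1"
  proof
    fix y assume "y \<in> mspace ?X"
    then have "y 0 \<in> range ?x" by (intro subshift_in_range) simp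
    then show "\<bar>y 0\<bar> = 1" by (auto simp: signs_def)
  qed
  show ?thesis
  proof (intro exI[of _ ?X] exI[of _ shift] conjI)
    show "topological_dynamical_system ?X shift"
      by (rule topological_dynamical_system_subshift[OF finite_range_signs])
    show "topological_entropy ?X shift = 0"
      by (rule topological_entropy_subshift_eq_0[OF finite_range_signs words_signs_subexponential[OF gaps]])
    show "\<exists>x\<in>mspace ?X. \<exists>f :: (nat \<Rightarrow> real) \<Rightarrow> real.
       continuous_map (mtopology_of ?X) euclidean f \<and>
       (\<forall>y\<in>mspace ?X. \<bar>f y\<bar> = 1) \<and>
       liminf (\<lambda>N. ereal (1 / (ln (real N) * \<tau> N) *
         (\<Sum>n=1..N. of_int (moebius_mu n) * f ((shift ^^ n) x) / real n))) > 0"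
      using f f_abs liminf self_in_subshift[of ?x] by (intro bexI[of _ ?x] exI[of _ ?f] conjI) simp_all
    show "\<forall>f :: (nat \<Rightarrow> real) \<Rightarrow> complex. continuous_map (mtopology_of ?X) euclidean f \<longrightarrow>
       (\<forall>x\<in>mspace ?X.
         (\<lambda>N. of_real (1 / ln (real N)) *
           (\<Sum>n=1..N. of_int (moebius_mu n) * f ((shift ^^ n) x) / of_nat n)) \<longlonglongrightarrow> 0)"
    proof (intro allI impI ballI)
      fix f :: "(nat \<Rightarrow> real) \<Rightarrow> complex" and u
      assume "continuous_map (mtopology_of ?X) euclidean f" "u \<in> mspace ?X"
      then show "(\<lambda>N. of_real (1 / ln (real N)) *
           (\<Sum>n=1..N. of_int (moebius_mu n) * f ((shift ^^ n) u) / of_nat n)) \<longlonglongrightarrow> 0"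
        unfolding top by (intro log_averaged_moebius_disjointness[OF gaps]) auto
    qed
  qed
qed

end
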